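(* Let $G$ be a finite group, $H \le G$ an abelian subgroup, and $\Omega\subseteq G$ a transversal for $G/H$. Let $\mathcal{A} = \{f_j\}_{j\in[n]}$ be a finite sequence in $L^2(G)$. For any $A,B>0$, the following are equivalent: (i) $E(\mathcal{A}) = \{R_h f_j\}_{h\in H,\, j\in[n]}$ is a frame for $S(\mathcal{A}) = \operatorname{span} E(\mathcal{A})$ with bounds $A,B$. (ii) For every $\alpha\in\hat H$, $\{(Z_r f_j)(\alpha)\}_{j\in[n]}$ is a frame for $J_{\mathcal{A}}(\alpha) := \operatorname{span}\{(Z_r f_j)(\alpha) : j\in[n]\}$ with bounds $A,B$.
   Context: $[n]=\{1,\dots,n\}$. $\hat H$ is the group of characters $\alpha\colon H\to\mathbb{T}$. A transversal for $G/H$ contains exactly one element of each left coset $xH$. $L^2(G)$ and $L^2(\Omega)$ are the spaces of complex functions with inner product $\langle f,g\rangle=\sum_x f(x)\overline{g(x)}$ (counting measure). For $f\in L^2(G)$ and $\alpha\in\hat H$, $(Z_r f)(\alpha)\in L^2(\Omega)$ is the function $(Z_r f)(\alpha)(x)=\sum_{h\in H}f(xh)\,\alpha(h)$, $x\in\Omega$. Right translation by $h\in H$ is $(R_hf)(x)=f(xh)$. A sequence $\{v_i\}_{i\in I}$ in a Hilbert space $\mathcal{H}$ is a frame for $\mathcal{H}$ with bounds $A,B>0$ if $A\|g\|^2\le\sum_{i\in I}|\langle g,v_i\rangle|^2\le B\|g\|^2$ for every $g\in\mathcal{H}$. *)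

theory Defs
  imports
    Complex_Main
    "HOL-Algebra.Coset"
    "HOL-Library.FuncSet"
    "HOL-Library.Function_Algebras"
begin

definition cfun_scale :: "complex \<Rightarrow> ('a \<Rightarrow> complex) \<Rightarrow> 'a \<Rightarrow> complex"
  where "cfun_scale c f = (\<lambda>x. c * f x)"

interpretation cfun: vector_space cfun_scale
  by unfold_locales (auto simp: cfun_scale_def plus_fun_def algebra_simps)

(* A function on a finite subset X of the ambient type is represented by its extension by 0,
   so that L2 X is a complex subspace of the space of all functions. *)
definition L2 :: "'a set \<Rightarrow> ('a \<Rightarrow> complex) set"
  where "L2 X = {f. \<forall>x. x \<notin> X \<longrightarrow> f x = 0}"

definition l2_inner :: "'a set \<Rightarrow> ('a \<Rightarrow> complex) \<Rightarrow> ('a \<Rightarrow> complex) \<Rightarrow> complex"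
  where "l2_inner X f g = (\<Sum>x\<in>X. f x * cnj (g x))"

definition l2_norm :: "'a set \<Rightarrow> ('a \<Rightarrow> complex) \<Rightarrow> real"
  where "l2_norm X f = sqrt (Re (l2_inner X f f))"

(* Frames indexed by a finite set for a subspace V of L2 X, X finite. Such a V is finite-dimensional
   and hence a Hilbert space. The frame is an indexed family: repeated vectors are counted with
   multiplicity. *)
definition is_frame ::
  "'a set \<Rightarrow> ('a \<Rightarrow> complex) set \<Rightarrow> 'i set \<Rightarrow> ('i \<Rightarrow> 'a \<Rightarrow> complex) \<Rightarrow> real \<Rightarrow> real \<Rightarrow> bool"
  where "is_frame X V I v A B \<longleftrightarrow>
    finite X \<and> cfun.subspace V \<and> V \<subseteq> L2 X \<and>
    finite I \<and> v ` I \<subseteq> V \<and> A > 0 \<and> B > 0 \<and>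
    (\<forall>g\<in>V. A * (l2_norm X g)\<^sup>2 \<le> (\<Sum>i\<in>I. (cmod (l2_inner X g (v i)))\<^sup>2) \<and>
            (\<Sum>i\<in>I. (cmod (l2_inner X g (v i)))\<^sup>2) \<le> B * (l2_norm X g)\<^sup>2)"

definition circle_group :: "complex monoid"
  where "circle_group = \<lparr>carrier = {z. cmod z = 1}, mult = (*), one = 1\<rparr>"

definition characters :: "('a, 'b) monoid_scheme \<Rightarrow> 'a set \<Rightarrow> ('a \<Rightarrow> complex) set"
  where "characters G H = hom (G\<lparr>carrier := H\<rparr>) circle_group \<inter> extensional H"

definition is_transversal :: "('a, 'b) monoid_scheme \<Rightarrow> 'a set \<Rightarrow> 'a set \<Rightarrow> bool"
  where "is_transversal G H \<Omega> \<longleftrightarrow>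
    \<Omega> \<subseteq> carrier G \<and> (\<forall>x\<in>carrier G. \<exists>!t. t \<in> \<Omega> \<and> t \<in> x <#\<^bsub>G\<^esub> H)"

definition right_translation ::
  "('a, 'b) monoid_scheme \<Rightarrow> 'a \<Rightarrow> ('a \<Rightarrow> complex) \<Rightarrow> 'a \<Rightarrow> complex"
  where "right_translation G h f = (\<lambda>x. if x \<in> carrier G then f (x \<otimes>\<^bsub>G\<^esub> h) else 0)"

definition zak ::
  "('a, 'b) monoid_scheme \<Rightarrow> 'a set \<Rightarrow> 'a set \<Rightarrow> ('a \<Rightarrow> complex) \<Rightarrow> ('a \<Rightarrow> complex) \<Rightarrow> 'a \<Rightarrow> complex"
  where "zak G H \<Omega> f \<alpha> =
    (\<lambda>x. if x \<in> \<Omega> then \<Sum>h\<in>H. f (x \<otimes>\<^bsub>G\<^esub> h) * \<alpha> h else 0)"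

end

theory Submission
  imports Defs "HOL-Algebra.Multiplicative_Group"
begin

text \<open>
  Characters of a finite abelian group separate points, so they satisfy both orthogonality relations,
  and the Zak transform is \<^term>\<open>sqrt (card H)\<close> times an isometry from \<open>L\<^sup>2(G)\<close> onto the direct sum,
  over the characters \<open>\<alpha>\<close>, of copies of \<open>L\<^sup>2(\<Omega>)\<close>.  It turns the translation \<open>R\<^sub>h\<close> into multiplication
  by the conjugate of \<open>\<alpha> h\<close>, so Plancherel on \<open>H\<close> shows that both the norm and the frame sum of \<open>g\<close>
  are averages over \<open>\<alpha>\<close> of the corresponding quantities for the fibres of \<open>g\<close>.  This gives
  (ii) \<open>\<Longrightarrow>\<close> (i).  Conversely, averaging the translates of \<open>f\<^sub>j\<close> against \<open>\<alpha>\<close> isolates one fibre, so each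
  element of \<open>J(\<alpha>)\<close> is the only nonzero fibre of some element of \<open>S\<close>.
\<close>

section \<open>Characters of finite abelian groups\<close>

lemma hom_circle_groupD:
  assumes "\<chi> \<in> hom K circle_group"
  shows "x \<in> carrier K \<Longrightarrow> cmod (\<chi> x) = 1"
    and "x \<in> carrier K \<Longrightarrow> y \<in> carrier K \<Longrightarrow> \<chi> (x \<otimes>\<^bsub>K\<^esub> y) = \<chi> x * \<chi> y"
  using assms by (auto simp: hom_def circle_group_def)

lemma hom_circle_groupI:
  assumes "\<And>x. x \<in> carrier K \<Longrightarrow> cmod (\<chi> x) = 1"
    and "\<And>x y. x \<in> carrier K \<Longrightarrow> y \<in> carrier K \<Longrightarrow> \<chi> (x \<otimes>\<^bsub>K\<^esub> y) = \<chi> x * \<chi> y"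
  shows "\<chi> \<in> hom K circle_group"
  using assms by (auto simp: hom_def circle_group_def)

lemma (in group) hom_circle_group_one:
  assumes "\<chi> \<in> hom G circle_group"
  shows "\<chi> \<one> = 1"
proof -
  have "\<chi> \<one> * \<chi> \<one> = \<chi> \<one>" "\<chi> \<one> \<noteq> 0"
    using hom_circle_groupD[OF assms, of \<one>] by (metis one_closed r_one, force)
  then show ?thesis by simp
qed

lemma (in group) hom_circle_group_pow:
  assumes "\<chi> \<in> hom G circle_group" "x \<in> carrier G"
  shows "\<chi> (x [^] (i::nat)) = \<chi> x ^ i"
  using assms by (induction i) (simp_all add: hom_circle_group_one hom_circle_groupD(2))

section \<open>Extending characters and separating points\<close>

lemma unit_complex_root_exists:
  assumes "cmod z = 1" "m > 0"
  shows "\<exists>w. w ^ m = z"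
proof
  have "cis (Arg z / real m) ^ m = cis (Arg z)"
    using assms(2) by (simp add: DeMoivre)
  also have "\<dots> = z"
    using assms(1) by (metis cis_Arg norm_zero sgn_div_norm inverse_1 scaleR_one zero_neq_one)
  finally show "cis (Arg z / real m) ^ m = z" .
qed

text \<open>The extension to the subgroup generated by \<open>K\<close> and \<open>g\<close> sends
  \<open>k \<otimes> g [^] i\<close> to \<open>\<chi> k * w ^ i\<close>. It is well defined because
  the powers of \<open>g\<close> in \<open>K\<close> are exactly the powers of
  \<open>g [^] m\<close>, where \<open>w ^ m\<close> has the right value. The root \<open>w\<close>
  stays a parameter so that the value at \<open>g\<close> can be prescribed.\<close>

lemma (in comm_group) extend_character_step:
  fixes m :: nat
  assumes fin: "finite (carrier G)" and K: "subgroup K G"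
    and \<chi>: "\<chi> \<in> hom (G\<lparr>carrier := K\<rparr>) circle_group"
    and g: "g \<in> carrier G" and m: "m > 0" "g [^] m \<in> K"
    and least: "\<And>i. 0 < i \<Longrightarrow> i < m \<Longrightarrow> g [^] i \<notin> K"
    and w: "w ^ m = \<chi> (g [^] m)"
  shows "\<exists>L \<psi>. subgroup L G \<and> K \<subseteq> L \<and> g \<in> L \<and> \<psi> \<in> hom (G\<lparr>carrier := L\<rparr>) circle_group \<and>
    (\<forall>k\<in>K. \<psi> k = \<chi> k) \<and> \<psi> g = w"
proof -
  interpret K: subgroup K G by (rule K)
  interpret KG: group "G\<lparr>carrier := K\<rparr>" by (rule K.subgroup_is_group[OF is_group])
  have \<chi>_norm: "cmod (\<chi> k) = 1" if "k \<in> K" for k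
    using hom_circle_groupD(1)[OF \<chi>] that by simp
  have \<chi>_mult: "\<chi> (k \<otimes> l) = \<chi> k * \<chi> l" if "k \<in> K" "l \<in> K" for k l
    using hom_circle_groupD(2)[OF \<chi>] that by simp
  have \<chi>_one: "\<chi> \<one> = 1"
    using KG.hom_circle_group_one[OF \<chi>] by simp
  \<comment> \<open>Division with remainder: \<open>g [^] (i mod m)\<close> also lies in
    \<open>K\<close>, so minimality of \<open>m\<close> forces \<open>m\<close> to divide
    \<open>i\<close>.\<close>
  have \<chi>_pow: "\<chi> (g [^] i) = w ^ i" if "g [^] i \<in> K" for i :: nat
  proof -
    define q where "q = i div m"
    have gi: "g [^] i = (g [^] m) [^] q \<otimes> g [^] (i mod m)"
      using g by (simp add: q_def nat_pow_mult nat_pow_pow)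
    have mq: "(g [^] m) [^] q \<in> K"
      using m(2) by (induction q) auto
    have "g [^] (i mod m) = inv ((g [^] m) [^] q) \<otimes> g [^] i"
      using g by (simp add: gi flip: m_assoc)
    then have "g [^] (i mod m) \<in> K"
      using mq that by simp
    then have "i mod m = 0"
      using least[of "i mod m"] m(1) by force
    then have im: "i = m * q"
      by (auto simp: q_def)
    have "\<chi> ((g [^] m) [^] q) = \<chi> (g [^] m) ^ q"
    proof (induction q)
      case 0
      then show ?case by (simp add: \<chi>_one)
    next
      case (Suc q)
      have "(g [^] m) [^] q \<in> K"
        using m(2) by (induction q) auto
      then show ?case using Suc m(2) by (simp add: \<chi>_mult)
    qed
    then show ?thesis
      using g by (simp add: im nat_pow_pow power_mult w)
  qed
  have w_norm: "cmod w = 1"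
  proof -
    have "cmod w ^ m = 1"
      using \<chi>_norm[OF m(2)] by (simp flip: norm_power add: w)
    then show ?thesis
      using m(1) power_eq_1_iff[of "cmod w" m] by simp
  qed
  \<comment> \<open>With the exponents ordered, cancelling \<open>g [^] i\<close> leaves the natural
    power \<open>g [^] (j - i)\<close>, which then lies in \<open>K\<close>.\<close>
  have wd_le: "\<chi> k * w ^ i = \<chi> l * w ^ j"
    if kl: "k \<in> K" "l \<in> K" and eq: "k \<otimes> g [^] i = l \<otimes> g [^] j" and ij: "i \<le> j" for k l and i j :: nat
  proof -
    have "g [^] j = g [^] (j - i) \<otimes> g [^] i"
      using ij g by (simp add: nat_pow_mult)
    with eq have "k \<otimes> g [^] i = (l \<otimes> g [^] (j - i)) \<otimes> g [^] i"
      using kl g by (simp add: m_assoc)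
    then have k: "k = l \<otimes> g [^] (j - i)"
      using kl g by (metis K.mem_carrier m_closed nat_pow_closed right_cancel)
    then have "g [^] (j - i) = inv l \<otimes> k"
      using kl g by (simp flip: m_assoc)
    then have "g [^] (j - i) \<in> K"
      using kl by simp
    then have "\<chi> k = \<chi> l * w ^ (j - i)"
      using kl by (simp add: k \<chi>_mult \<chi>_pow)
    then show ?thesis
      using ij by (simp add: mult.assoc flip: power_add)
  qed
  have wd: "\<chi> k * w ^ i = \<chi> l * w ^ j"
    if "k \<in> K" "l \<in> K" "k \<otimes> g [^] i = l \<otimes> g [^] j" for k l and i j :: nat
    using wd_le[of k l i j] wd_le[of l k j i] that by (metis nat_le_linear)
  \<comment> \<open>Natural exponents suffice because \<open>g\<close> has finite order. The value
    \<open>\<psi> x\<close> is read off from some representation of \<open>x\<close>, and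
    \<open>wd\<close> makes it independent of the choice.\<close>
  define L where "L = {k \<otimes> g [^] (i::nat) | k i. k \<in> K}"
  define \<psi> where "\<psi> x = (SOME z. \<exists>k\<in>K. \<exists>i::nat. x = k \<otimes> g [^] i \<and> z = \<chi> k * w ^ i)" for x
  have \<psi>: "\<psi> (k \<otimes> g [^] i) = \<chi> k * w ^ i" if k: "k \<in> K" for k and i :: nat
  proof -
    have "\<exists>l\<in>K. \<exists>j::nat. k \<otimes> g [^] i = l \<otimes> g [^] j \<and> \<psi> (k \<otimes> g [^] i) = \<chi> l * w ^ j"
      unfolding \<psi>_def by (rule someI[where x = "\<chi> k * w ^ i"]) (use k in blast)
    then show ?thesis
      using wd[OF k] by metis
  qed
  have mult: "(k \<otimes> g [^] i) \<otimes> (l \<otimes> g [^] j) = (k \<otimes> l) \<otimes> g [^] (i + j)"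
    if "k \<in> K" "l \<in> K" for k l and i j :: nat
    using that g by (simp add: m_ac flip: nat_pow_mult)
  have L_sub: "subgroup L G"
  proof (rule subgroupI)
    show "L \<subseteq> carrier G" by (auto simp: L_def g)
    show "L \<noteq> {}" using K.one_closed unfolding L_def by blast
  next
    fix x assume "x \<in> L"
    then obtain k and i :: nat where k: "k \<in> K" and x: "x = k \<otimes> g [^] i"
      by (auto simp: L_def)
    \<comment> \<open>The power \<open>g [^] (i * (order G - 1))\<close> inverts
      \<open>g [^] i\<close> and keeps the exponent natural.\<close>
    have "order G > 0" using fin by (simp add: order_gt_0_iff_finite)
    then have "g [^] (i * (order G - 1)) \<otimes> g [^] i = g [^] (order G * i)"
      using g by (cases "order G") (simp_all add: nat_pow_mult algebra_simps)
    also have "\<dots> = \<one>"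
      using g by (simp add: pow_order_eq_1 flip: nat_pow_pow)
    finally have "inv (g [^] i) = g [^] (i * (order G - 1))"
      using g by (simp add: inv_equality)
    then have "inv x = inv k \<otimes> g [^] (i * (order G - 1))"
      using k g by (simp add: x inv_mult)
    then show "inv x \<in> L" using k unfolding L_def by blast
  next
    fix x y assume "x \<in> L" "y \<in> L"
    then show "x \<otimes> y \<in> L"
      by (clarsimp simp: L_def mult) (use K.m_closed in blast)
  qed
  show ?thesis
  proof (intro exI[of _ L] exI[of _ \<psi>] conjI ballI)
    show "subgroup L G" by (rule L_sub)
    show "K \<subseteq> L"
    proof
      fix k assume "k \<in> K"
      then have "k = k \<otimes> g [^] (0::nat)" by simp
      then show "k \<in> L" using \<open>k \<in> K\<close> unfolding L_def by blast
    qed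
    show "g \<in> L"
    proof -
      have "g = \<one> \<otimes> g [^] (1::nat)" using g by simp
      then show ?thesis using K.one_closed unfolding L_def by blast
    qed
    show "\<psi> \<in> hom (G\<lparr>carrier := L\<rparr>) circle_group"
    proof (rule hom_circle_groupI)
      fix x assume "x \<in> carrier (G\<lparr>carrier := L\<rparr>)"
      then show "cmod (\<psi> x) = 1"
        by (auto simp: L_def \<psi> norm_mult norm_power \<chi>_norm w_norm)
    next
      fix x y assume "x \<in> carrier (G\<lparr>carrier := L\<rparr>)" "y \<in> carrier (G\<lparr>carrier := L\<rparr>)"
      then show "\<psi> (x \<otimes>\<^bsub>G\<lparr>carrier := L\<rparr>\<^esub> y) = \<psi> x * \<psi> y"
        by (auto simp: L_def \<psi> mult \<chi>_mult power_add)
    qed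
    show "\<psi> k = \<chi> k" if "k \<in> K" for k
      using \<psi>[of k 0] that by simp
    show "\<psi> g = w"
      using \<psi>[of \<one> 1] g by (simp add: \<chi>_one)
  qed
qed

text \<open>The group order is an admissible exponent, so there is a least positive one. For
  commutative \<open>G\<close> it is the order of the coset of \<open>g\<close> modulo
  \<open>K\<close>.\<close>

lemma (in group) least_pow_in_subgroup:
  assumes fin: "finite (carrier G)" and K: "subgroup K G" and g: "g \<in> carrier G"
  shows "\<exists>m::nat. m > 0 \<and> g [^] m \<in> K \<and> (\<forall>i. 0 < i \<longrightarrow> i < m \<longrightarrow> g [^] i \<notin> K)"
proof -
  let ?P = "\<lambda>i::nat. 0 < i \<and> g [^] i \<in> K"
  have "?P (order G)"
    using pow_order_eq_1[OF g] K order_gt_0_iff_finite fin by (simp add: subgroup.one_closed)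
  then have "\<exists>m. ?P m \<and> (\<forall>i<m. \<not> ?P i)"
    by (rule exists_least_iff[THEN iffD1, OF exI])
  then show ?thesis by blast
qed

text \<open>Strong induction on the number of elements outside \<open>K\<close>: if some
  \<open>g\<close> is missing, any \<open>m\<close>-th root of \<open>\<chi> (g [^] m)\<close>
  extends \<open>\<chi>\<close> to a strictly larger subgroup.\<close>

lemma (in comm_group) extend_character:
  assumes fin: "finite (carrier G)" and "subgroup K G"
    and "\<chi> \<in> hom (G\<lparr>carrier := K\<rparr>) circle_group"
  shows "\<exists>\<psi>\<in>hom G circle_group. \<forall>k\<in>K. \<psi> k = \<chi> k"
  using assms(2,3)
proof (induction "card (carrier G - K)" arbitrary: K \<chi> rule: less_induct)
  case less
  show ?case
  proof (cases "K = carrier G")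
    case True
    then show ?thesis using less.prems(2) by auto
  next
    case False
    then obtain g where g: "g \<in> carrier G" "g \<notin> K"
      using subgroup.subset[OF less.prems(1)] by blast
    obtain m :: nat where m: "m > 0" "g [^] m \<in> K" "\<And>i. 0 < i \<Longrightarrow> i < m \<Longrightarrow> g [^] i \<notin> K"
      using least_pow_in_subgroup[OF fin less.prems(1) g(1)] by blast
    have "cmod (\<chi> (g [^] m)) = 1"
      using hom_circle_groupD(1)[OF less.prems(2)] m(2) by simp
    then obtain w where w: "w ^ m = \<chi> (g [^] m)"
      using unit_complex_root_exists m(1) by blast
    obtain L \<psi> where L: "subgroup L G" "K \<subseteq> L" "g \<in> L"
      "\<psi> \<in> hom (G\<lparr>carrier := L\<rparr>) circle_group" "\<forall>k\<in>K. \<psi> k = \<chi> k"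
      using extend_character_step[OF fin less.prems g(1) m w] by blast
    have "card (carrier G - L) < card (carrier G - K)"
      using fin g L(2,3) by (intro psubset_card_mono) auto
    then obtain \<phi> where "\<phi> \<in> hom G circle_group" "\<forall>k\<in>L. \<phi> k = \<psi> k"
      using less.hyps L(1,4) by blast
    then show ?thesis using L(2,5) by (metis subsetD)
  qed
qed

text \<open>The trivial character of \<open>{\<one>}\<close> is extended with a nontrivial root of
  unity as its value at \<open>x\<close>, and then to all of \<open>G\<close>.\<close>

lemma (in comm_group) characters_separate_one:
  assumes fin: "finite (carrier G)" and x: "x \<in> carrier G" "x \<noteq> \<one>"
  shows "\<exists>\<psi>\<in>hom G circle_group. \<psi> x \<noteq> 1"
proof -
  have triv: "subgroup {\<one>} G" by (rule triv_subgroup)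
  have one: "(\<lambda>_. 1) \<in> hom (G\<lparr>carrier := {\<one>}\<rparr>) circle_group"
    by (rule hom_circle_groupI) auto
  obtain m :: nat where m: "m > 0" "x [^] m \<in> {\<one>}" "\<And>i. 0 < i \<Longrightarrow> i < m \<Longrightarrow> x [^] i \<notin> {\<one>}"
    using least_pow_in_subgroup[OF fin triv x(1)] by blast
  \<comment> \<open>Here \<open>m\<close> is the order of \<open>x\<close>, hence at least 2. There
    are \<open>m\<close> complex \<open>m\<close>-th roots of unity, so one of them differs from
    1.\<close>
  have "m \<noteq> 1" using m(2) x by auto
  have "\<exists>w. w ^ m = 1 \<and> w \<noteq> (1::complex)"
  proof (rule ccontr)
    assume "\<not> ?thesis"
    then have "{z::complex. z ^ m = 1} \<subseteq> {1}" by auto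
    then have "card {z::complex. z ^ m = 1} \<le> 1"
      using card_mono[of "{1::complex}"] by fastforce
    then show False using card_roots_unity_eq[OF m(1)] m(1) \<open>m \<noteq> 1\<close> by simp
  qed
  then obtain w :: complex where w: "w ^ m = 1" "w \<noteq> 1" by blast
  obtain L \<psi> where L: "subgroup L G" "x \<in> L" "\<psi> \<in> hom (G\<lparr>carrier := L\<rparr>) circle_group" "\<psi> x = w"
    using extend_character_step[OF fin triv one x(1) m w(1)] by blast
  then show ?thesis
    using extend_character[OF fin L(1,3)] w(2) by metis
qed

section \<open>Orthogonality relations and Plancherel on \<open>H\<close>\<close>

lemma charactersD:
  assumes "\<alpha> \<in> characters G H"
  shows "h \<in> H \<Longrightarrow> cmod (\<alpha> h) = 1"
    and "h \<in> H \<Longrightarrow> k \<in> H \<Longrightarrow> \<alpha> (h \<otimes>\<^bsub>G\<^esub> k) = \<alpha> h * \<alpha> k"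
    and "h \<in> H \<Longrightarrow> \<alpha> h * cnj (\<alpha> h) = 1"
proof -
  have \<alpha>: "\<alpha> \<in> hom (G\<lparr>carrier := H\<rparr>) circle_group"
    using assms by (simp add: characters_def)
  show "cmod (\<alpha> h) = 1" if "h \<in> H"
    using hom_circle_groupD(1)[OF \<alpha>] that by simp
  then show "\<alpha> h * cnj (\<alpha> h) = 1" if "h \<in> H"
    using that by (simp add: complex_norm_square[symmetric])
  show "\<alpha> (h \<otimes>\<^bsub>G\<^esub> k) = \<alpha> h * \<alpha> k" if "h \<in> H" "k \<in> H"
    using hom_circle_groupD(2)[OF \<alpha>] that by simp
qed

lemma characters_ext:
  assumes "\<alpha> \<in> characters G H" "\<beta> \<in> characters G H" "\<And>h. h \<in> H \<Longrightarrow> \<alpha> h = \<beta> h"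
  shows "\<alpha> = \<beta>"
  using assms by (auto simp: characters_def intro: extensionalityI)

locale finite_abelian_subgroup = group G for G :: "('a, 'b) monoid_scheme" (structure) +
  fixes H :: "'a set"
  assumes subgroup_H: "subgroup H G"
    and finite_H: "finite H"
    and comm_group_H: "comm_group (G\<lparr>carrier := H\<rparr>)"
begin

sublocale H: subgroup H G by (rule subgroup_H)
sublocale HG: comm_group "G\<lparr>carrier := H\<rparr>" by (rule comm_group_H)

lemma card_H_pos: "card H > 0"
  using finite_H H.one_closed card_gt_0_iff by blast

text \<open>Restriction selects the representative that is \<open>undefined\<close> off
  \<open>H\<close>, which makes equality of characters an equality of functions.\<close>

lemma charactersI:
  assumes "\<psi> \<in> hom (G\<lparr>carrier := H\<rparr>) circle_group"
  shows "restrict \<psi> H \<in> characters G H"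
  using assms by (auto simp: characters_def hom_def circle_group_def)

text \<open>The values are roots of unity of order dividing \<open>card H\<close>, so the characters
  lie in a finite set of extensional functions.\<close>

lemma finite_characters: "finite (characters G H)"
proof (rule finite_subset)
  have "\<alpha> h ^ card H = 1" if "\<alpha> \<in> characters G H" "h \<in> H" for \<alpha> h
  proof -
    have \<alpha>: "\<alpha> \<in> hom (G\<lparr>carrier := H\<rparr>) circle_group"
      using that(1) by (simp add: characters_def)
    have "\<alpha> h ^ card H = \<alpha> \<one>"
      using HG.hom_circle_group_pow[OF \<alpha>, of h "card H"] HG.pow_order_eq_1[of h] that(2)
      by (simp add: order_def)
    then show ?thesis using HG.hom_circle_group_one[OF \<alpha>] by simp
  qed
  then show "characters G H \<subseteq> H \<rightarrow>\<^sub>E {z. z ^ card H = 1}"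
    by (auto simp: characters_def PiE_def)
  show "finite (H \<rightarrow>\<^sub>E {z::complex. z ^ card H = 1})"
    using finite_H card_H_pos by (intro finite_PiE finite_roots_unity) auto
qed

text \<open>Substituting \<open>k \<otimes> h\<close> for \<open>h\<close> multiplies the sum by
  \<open>\<alpha> k * cnj (\<beta> k)\<close>, which is not 1 when \<open>\<alpha>\<close> and
  \<open>\<beta>\<close> differ at \<open>k\<close>; hence the sum vanishes.\<close>

lemma characters_orthogonal:
  assumes \<alpha>: "\<alpha> \<in> characters G H" and \<beta>: "\<beta> \<in> characters G H"
  shows "(\<Sum>h\<in>H. \<alpha> h * cnj (\<beta> h)) = (if \<alpha> = \<beta> then of_nat (card H) else 0)"
proof (cases "\<alpha> = \<beta>")
  case True
  then show ?thesis by (simp add: charactersD(3)[OF \<beta>])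
next
  case False
  then obtain k where k: "k \<in> H" "\<alpha> k \<noteq> \<beta> k"
    using characters_ext[OF \<alpha> \<beta>] by blast
  let ?S = "\<Sum>h\<in>H. \<alpha> h * cnj (\<beta> h)"
  have "?S = (\<Sum>h\<in>H. \<alpha> (k \<otimes> h) * cnj (\<beta> (k \<otimes> h)))"
    by (rule sum.reindex_bij_witness[where i = "\<lambda>h. k \<otimes> h" and j = "\<lambda>h. inv k \<otimes> h"])
      (use k in \<open>auto simp flip: m_assoc\<close>)
  also have "\<dots> = \<alpha> k * cnj (\<beta> k) * ?S"
    using k by (simp add: charactersD(2)[OF \<alpha>] charactersD(2)[OF \<beta>] sum_distrib_left mult_ac)
  finally have "\<alpha> k * cnj (\<beta> k) = 1 \<or> ?S = 0"
    by (simp only: mult_cancel_right1) blast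
  moreover have "\<alpha> k * cnj (\<beta> k) \<noteq> 1"
  proof
    assume "\<alpha> k * cnj (\<beta> k) = 1"
    then have "\<alpha> k * (\<beta> k * cnj (\<beta> k)) = \<beta> k"
      by (metis mult.left_commute mult.right_neutral)
    then show False using k by (simp add: charactersD(3)[OF \<beta>])
  qed
  ultimately show ?thesis using False by simp
qed

lemma characters_separate:
  assumes "h \<in> H" "k \<in> H" "h \<noteq> k"
  obtains \<beta> where "\<beta> \<in> characters G H" "\<beta> h \<noteq> \<beta> k"
proof -
  have ne: "h \<otimes> inv k \<noteq> \<one>"
    using assms by (metis H.mem_carrier inv_closed inv_equality inv_inv)
  then obtain \<psi> where \<psi>: "\<psi> \<in> hom (G\<lparr>carrier := H\<rparr>) circle_group" "\<psi> (h \<otimes> inv k) \<noteq> 1"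
    using HG.characters_separate_one[of "h \<otimes> inv k"] assms finite_H by auto
  have "\<psi> h = \<psi> (h \<otimes> inv k) * \<psi> k"
  proof -
    have "(h \<otimes> inv k) \<otimes> k = h" using assms by (simp add: m_assoc)
    then show ?thesis
      using hom_circle_groupD(2)[OF \<psi>(1), of "h \<otimes> inv k" k] assms by simp
  qed
  moreover have "\<psi> k \<noteq> 0"
    using hom_circle_groupD(1)[OF \<psi>(1), of k] assms by auto
  ultimately have "\<psi> h \<noteq> \<psi> k" using \<psi>(2) by simp
  then show thesis
    using that[OF charactersI[OF \<psi>(1)]] assms by simp
qed

text \<open>Multiplication by a character \<open>\<beta>\<close> that separates \<open>h\<close> and
  \<open>k\<close> permutes the characters and multiplies the sum by a number other than 1.\<close>

lemma characters_dual_sum_zero: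
  assumes "h \<in> H" "k \<in> H" "h \<noteq> k"
  shows "(\<Sum>\<alpha>\<in>characters G H. \<alpha> h * cnj (\<alpha> k)) = 0"
proof -
  obtain \<beta> where \<beta>: "\<beta> \<in> characters G H" "\<beta> h \<noteq> \<beta> k"
    using characters_separate[OF assms] .
  let ?m = "\<lambda>\<alpha>. restrict (\<lambda>x. \<beta> x * \<alpha> x) H"
  let ?S = "\<Sum>\<alpha>\<in>characters G H. \<alpha> h * cnj (\<alpha> k)"
  have closed: "?m \<alpha> \<in> characters G H" if \<alpha>: "\<alpha> \<in> characters G H" for \<alpha>
    by (rule charactersI, rule hom_circle_groupI)
      (auto simp: charactersD[OF \<alpha>] charactersD[OF \<beta>(1)] norm_mult)
  have inj: "inj_on ?m (characters G H)"
  proof (rule inj_onI)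
    fix \<alpha> \<gamma>
    assume *: "\<alpha> \<in> characters G H" "\<gamma> \<in> characters G H" "?m \<alpha> = ?m \<gamma>"
    show "\<alpha> = \<gamma>"
    proof (rule characters_ext[OF *(1,2)])
      fix x assume x: "x \<in> H"
      then have "\<beta> x * \<alpha> x = \<beta> x * \<gamma> x" using fun_cong[OF *(3), of x] by simp
      moreover have "\<beta> x \<noteq> 0" using charactersD(1)[OF \<beta>(1) x] by auto
      ultimately show "\<alpha> x = \<gamma> x" by simp
    qed
  qed
  \<comment> \<open>Finiteness turns injectivity into bijectivity, without constructing the inverse
    character.\<close>
  have "bij_betw ?m (characters G H) (characters G H)"
    using inj endo_inj_surj[OF finite_characters _ inj] closed by (auto simp: bij_betw_def)
  then have "?S = (\<Sum>\<alpha>\<in>characters G H. ?m \<alpha> h * cnj (?m \<alpha> k))"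
    by (rule sum.reindex_bij_betw[symmetric])
  also have "\<dots> = \<beta> h * cnj (\<beta> k) * ?S"
    using assms by (simp add: sum_distrib_left mult_ac)
  finally have "\<beta> h * cnj (\<beta> k) = 1 \<or> ?S = 0"
    by (simp only: mult_cancel_right1) blast
  moreover have "\<beta> h * cnj (\<beta> k) \<noteq> 1"
  proof
    assume "\<beta> h * cnj (\<beta> k) = 1"
    then have "\<beta> h * (\<beta> k * cnj (\<beta> k)) = \<beta> k"
      by (metis mult.left_commute mult.right_neutral)
    then show False using \<beta>(2) assms by (simp add: charactersD(3)[OF \<beta>(1)])
  qed
  ultimately show ?thesis by simp
qed

text \<open>Double counting of the sum of \<open>\<alpha> h\<close> over all pairs: summing over
  \<open>h\<close> first leaves only the trivial character, summing over \<open>\<alpha>\<close>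
  first leaves only \<open>h = \<one>\<close>.\<close>

lemma card_characters: "card (characters G H) = card H"
proof -
  let ?e = "restrict (\<lambda>_. 1 :: complex) H"
  have e: "?e \<in> characters G H"
    by (rule charactersI, rule hom_circle_groupI) auto
  have one: "\<alpha> \<one> = 1" if "\<alpha> \<in> characters G H" for \<alpha>
    using HG.hom_circle_group_one that by (simp add: characters_def)
  have "of_nat (card H) = (\<Sum>\<alpha>\<in>characters G H. if \<alpha> = ?e then of_nat (card H) else 0 :: complex)"
    using e finite_characters by simp
  also have "\<dots> = (\<Sum>\<alpha>\<in>characters G H. \<Sum>h\<in>H. \<alpha> h * cnj (?e h))"
    using characters_orthogonal[OF _ e] by (intro sum.cong) auto
  also have "\<dots> = (\<Sum>h\<in>H. \<Sum>\<alpha>\<in>characters G H. \<alpha> h * cnj (\<alpha> \<one>))"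
    by (subst sum.swap) (simp add: one)
  also have "\<dots> = (\<Sum>h\<in>H. if h = \<one> then of_nat (card (characters G H)) else 0)"
    using characters_dual_sum_zero[OF _ H.one_closed]
    by (intro sum.cong refl) (auto simp: one)
  also have "\<dots> = of_nat (card (characters G H))"
    using finite_H by simp
  finally show ?thesis by (simp only: of_nat_eq_iff)
qed

lemma characters_dual_orthogonal:
  assumes "h \<in> H" "k \<in> H"
  shows "(\<Sum>\<alpha>\<in>characters G H. \<alpha> h * cnj (\<alpha> k)) = (if h = k then of_nat (card H) else 0)"
  using characters_dual_sum_zero[OF assms] assms
  by (auto simp: charactersD(3) card_characters)

text \<open>Expanding the square gives a double sum over characters, in which orthogonality over
  \<open>H\<close> keeps only the diagonal.\<close>

lemma plancherel:
  "(\<Sum>h\<in>H. (cmod (\<Sum>\<alpha>\<in>characters G H. \<alpha> h * c \<alpha>))\<^sup>2)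
     = real (card H) * (\<Sum>\<alpha>\<in>characters G H. (cmod (c \<alpha>))\<^sup>2)"
proof -
  let ?C = "characters G H"
  have "complex_of_real (\<Sum>h\<in>H. (cmod (\<Sum>\<alpha>\<in>?C. \<alpha> h * c \<alpha>))\<^sup>2)
      = (\<Sum>h\<in>H. \<Sum>\<alpha>\<in>?C. \<Sum>\<beta>\<in>?C. (c \<alpha> * cnj (c \<beta>)) * (\<alpha> h * cnj (\<beta> h)))"
    by (simp only: of_real_sum complex_norm_square cnj_sum sum_product) (simp add: mult_ac)
  also have "\<dots> = (\<Sum>\<alpha>\<in>?C. \<Sum>\<beta>\<in>?C. (c \<alpha> * cnj (c \<beta>)) * (\<Sum>h\<in>H. \<alpha> h * cnj (\<beta> h)))"
    unfolding sum_distrib_left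
    by (subst sum.swap, rule sum.cong[OF refl], rule sum.swap)
  also have "\<dots> = (\<Sum>\<alpha>\<in>?C. \<Sum>\<beta>\<in>?C. if \<alpha> = \<beta> then of_nat (card H) * (c \<alpha> * cnj (c \<alpha>)) else 0)"
    by (intro sum.cong refl) (simp add: characters_orthogonal)
  also have "\<dots> = of_nat (card H) * (\<Sum>\<alpha>\<in>?C. c \<alpha> * cnj (c \<alpha>))"
    using finite_characters by (simp add: sum_distrib_left)
  also have "\<dots> = complex_of_real (real (card H) * (\<Sum>\<alpha>\<in>?C. (cmod (c \<alpha>))\<^sup>2))"
    by (simp only: of_real_mult of_real_sum complex_norm_square of_real_of_nat_eq)
  finally show ?thesis by (simp only: of_real_eq_iff)
qed

end

section \<open>The Zak transform\<close>

lemma l2_norm_square: "(l2_norm X f)\<^sup>2 = Re (l2_inner X f f)"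
  by (simp add: l2_norm_def l2_inner_def sum_nonneg flip: power2_eq_square add: mult.commute)

lemma l2_inner_cfun_scale_right: "l2_inner X f (cfun_scale c g) = cnj c * l2_inner X f g"
  by (simp add: l2_inner_def cfun_scale_def sum_distrib_left mult_ac)

lemma l2_zero: "l2_inner X 0 g = 0" "l2_norm X 0 = 0"
  by (simp_all add: l2_inner_def l2_norm_def)

lemma subspace_L2: "cfun.subspace (L2 X)"
  by (auto simp: cfun.subspace_def L2_def cfun_scale_def)

lemma zak_add: "zak G H \<Omega> (f + g) \<alpha> = zak G H \<Omega> f \<alpha> + zak G H \<Omega> g \<alpha>"
  by (auto simp: zak_def fun_eq_iff algebra_simps sum.distrib)

lemma zak_cfun_scale: "zak G H \<Omega> (cfun_scale c f) \<alpha> = cfun_scale c (zak G H \<Omega> f \<alpha>)"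
  by (auto simp: zak_def cfun_scale_def fun_eq_iff sum_distrib_left mult_ac)

lemma zak_zero: "zak G H \<Omega> 0 \<alpha> = 0"
  by (auto simp: zak_def fun_eq_iff)

lemma zak_sum: "zak G H \<Omega> (\<Sum>i\<in>I. f i) \<alpha> = (\<Sum>i\<in>I. zak G H \<Omega> (f i) \<alpha>)"
  by (induction I rule: infinite_finite_induct)
    (simp_all only: sum.infinite sum.empty sum.insert zak_zero zak_add not_False_eq_True)

lemma zak_in_L2: "zak G H \<Omega> f \<alpha> \<in> L2 \<Omega>"
  by (simp add: zak_def L2_def)

locale zak_transform = finite_abelian_subgroup G H
  for G :: "('a, 'b) monoid_scheme" (structure) and H +
  fixes \<Omega> :: "'a set"
  assumes finite_G: "finite (carrier G)"
    and transversal: "is_transversal G H \<Omega>"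
begin

abbreviation "chars \<equiv> characters G H"
abbreviation "Z \<equiv> zak G H \<Omega>"
abbreviation "R \<equiv> right_translation G"

section \<open>Coset decomposition and the Parseval identity\<close>

lemma transversal_subset: "\<Omega> \<subseteq> carrier G"
  using transversal by (simp add: is_transversal_def)

text \<open>If two products agree, both representatives lie in the coset of that product, which
  meets \<Omega> only once. Conversely, the representative \<open>t = x \<otimes> h\<close> of the
  coset of \<open>x\<close> gives \<open>x = t \<otimes> inv h\<close>.\<close>

lemma bij_transversal: "bij_betw (\<lambda>(t, h). t \<otimes> h) (\<Omega> \<times> H) (carrier G)"
proof (rule bij_betw_imageI)
  show "inj_on (\<lambda>(t, h). t \<otimes> h) (\<Omega> \<times> H)"
  proof (rule inj_onI, clarify)
    fix t h t' h'
    assume *: "t \<in> \<Omega>" "h \<in> H" "t' \<in> \<Omega>" "h' \<in> H" and eq: "t \<otimes> h = t' \<otimes> h'"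
    have c: "t \<in> carrier G" "t' \<in> carrier G" using * transversal_subset by auto
    have "t = (t \<otimes> h) \<otimes> inv h" "t' = (t \<otimes> h) \<otimes> inv h'"
      using * c by (simp_all add: m_assoc) (simp add: eq m_assoc flip: m_assoc[of t h])
    then have "t \<in> (t \<otimes> h) <# H" "t' \<in> (t \<otimes> h) <# H"
      using * by (auto simp: l_coset_def)
    moreover have "t \<otimes> h \<in> carrier G" using * c by simp
    ultimately have "t = t'"
      using transversal * unfolding is_transversal_def by blast
    then show "t = t' \<and> h = h'" using eq * c by simp
  qed
  show "(\<lambda>(t, h). t \<otimes> h) ` (\<Omega> \<times> H) = carrier G"
  proof (intro equalityI subsetI)
    fix x assume x: "x \<in> carrier G"
    then obtain t where "t \<in> \<Omega>" "t \<in> x <# H"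
      using transversal unfolding is_transversal_def by blast
    then obtain h where h: "h \<in> H" "t = x \<otimes> h" by (auto simp: l_coset_def)
    then have "x = t \<otimes> inv h" using x by (simp add: m_assoc)
    then show "x \<in> (\<lambda>(t, h). t \<otimes> h) ` (\<Omega> \<times> H)"
      using \<open>t \<in> \<Omega>\<close> h(1) by (auto intro!: image_eqI[of _ _ "(t, inv h)"])
  qed (use transversal_subset in auto)
qed

lemma sum_transversal: "(\<Sum>x\<in>carrier G. F x) = (\<Sum>t\<in>\<Omega>. \<Sum>h\<in>H. F (t \<otimes> h))"
  using sum.reindex_bij_betw[OF bij_transversal, of F]
  by (simp add: sum.cartesian_product case_prod_unfold)

text \<open>With the sum over characters innermost, dual orthogonality forces \<open>h = k\<close>,
  and the products \<open>t \<otimes> h\<close> run through the group once.\<close>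

lemma zak_parseval:
  "(\<Sum>\<alpha>\<in>chars. l2_inner \<Omega> (Z f \<alpha>) (Z g \<alpha>)) = of_nat (card H) * l2_inner (carrier G) f g"
proof -
  have "(\<Sum>\<alpha>\<in>chars. l2_inner \<Omega> (Z f \<alpha>) (Z g \<alpha>))
      = (\<Sum>\<alpha>\<in>chars. \<Sum>t\<in>\<Omega>. \<Sum>h\<in>H. \<Sum>k\<in>H. f (t \<otimes> h) * cnj (g (t \<otimes> k)) * (\<alpha> h * cnj (\<alpha> k)))"
    by (simp add: l2_inner_def zak_def sum_product mult_ac)
  also have "\<dots> = (\<Sum>t\<in>\<Omega>. \<Sum>h\<in>H. \<Sum>k\<in>H.
      f (t \<otimes> h) * cnj (g (t \<otimes> k)) * (\<Sum>\<alpha>\<in>chars. \<alpha> h * cnj (\<alpha> k)))"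
    by (simp add: sum_distrib_left sum.swap[of _ _ chars])
  also have "\<dots> = (\<Sum>t\<in>\<Omega>. \<Sum>h\<in>H. \<Sum>k\<in>H.
      if h = k then of_nat (card H) * (f (t \<otimes> h) * cnj (g (t \<otimes> h))) else 0)"
    by (intro sum.cong refl) (simp add: characters_dual_orthogonal)
  also have "\<dots> = (\<Sum>t\<in>\<Omega>. \<Sum>h\<in>H. of_nat (card H) * (f (t \<otimes> h) * cnj (g (t \<otimes> h))))"
    using finite_H by simp
  also have "\<dots> = of_nat (card H) * l2_inner (carrier G) f g"
    by (simp add: l2_inner_def sum_transversal sum_distrib_left)
  finally show ?thesis .
qed

lemma zak_norm:
  "(\<Sum>\<alpha>\<in>chars. (l2_norm \<Omega> (Z f \<alpha>))\<^sup>2) = real (card H) * (l2_norm (carrier G) f)\<^sup>2"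
  using arg_cong[OF zak_parseval[of f f], of Re] by (simp add: l2_norm_square)

text \<open>Reindexing \<open>H\<close> by right multiplication with \<open>h\<close> absorbs the
  translation; the compensating factor is the inverse of \<open>\<alpha> h\<close>, which is its
  conjugate.\<close>

lemma zak_right_translation:
  assumes h: "h \<in> H" and \<alpha>: "\<alpha> \<in> chars"
  shows "Z (R h f) \<alpha> = cfun_scale (cnj (\<alpha> h)) (Z f \<alpha>)"
proof
  fix x
  show "Z (R h f) \<alpha> x = cfun_scale (cnj (\<alpha> h)) (Z f \<alpha>) x"
  proof (cases "x \<in> \<Omega>")
    case True
    then have x: "x \<in> carrier G" using transversal_subset by auto
    \<comment> \<open>The inserted factor \<open>\<alpha> h * cnj (\<alpha> h)\<close> equals 1; its
      first half merges with \<open>\<alpha> k\<close> into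
      \<open>\<alpha> (k \<otimes> h)\<close>.\<close>
    have "Z (R h f) \<alpha> x = (\<Sum>k\<in>H. f (x \<otimes> (k \<otimes> h)) * (\<alpha> k * (\<alpha> h * cnj (\<alpha> h))))"
      using True x h by (simp add: zak_def right_translation_def m_assoc charactersD(3)[OF \<alpha>])
    also have "\<dots> = (\<Sum>k\<in>H. f (x \<otimes> (k \<otimes> h)) * \<alpha> (k \<otimes> h) * cnj (\<alpha> h))"
      using h by (simp add: charactersD(2)[OF \<alpha>] mult_ac)
    also have "\<dots> = (\<Sum>k\<in>H. f (x \<otimes> k) * \<alpha> k * cnj (\<alpha> h))"
      by (rule sum.reindex_bij_witness[where i = "\<lambda>k. k \<otimes> inv h" and j = "\<lambda>k. k \<otimes> h"])
        (use h in \<open>auto simp: m_assoc\<close>)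
    also have "\<dots> = cfun_scale (cnj (\<alpha> h)) (Z f \<alpha>) x"
      using True by (simp add: zak_def cfun_scale_def sum_distrib_left mult_ac)
    finally show ?thesis .
  qed (simp add: zak_def cfun_scale_def)
qed

text \<open>As a function of \<open>h\<close>, \<open>card H\<close> times the inner product of
  \<open>g\<close> with \<open>R h f\<close> is a combination of characters with the fibre inner
  products as coefficients, so Plancherel on \<open>H\<close> applies.\<close>

lemma frame_sum_translates:
  "real (card H) * (\<Sum>h\<in>H. (cmod (l2_inner (carrier G) g (R h f)))\<^sup>2)
     = (\<Sum>\<alpha>\<in>chars. (cmod (l2_inner \<Omega> (Z g \<alpha>) (Z f \<alpha>)))\<^sup>2)" (is "?N * ?S = ?T")
proof -
  have *: "of_nat (card H) * l2_inner (carrier G) g (R h f)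
      = (\<Sum>\<alpha>\<in>chars. \<alpha> h * l2_inner \<Omega> (Z g \<alpha>) (Z f \<alpha>))" if "h \<in> H" for h
    using that by (simp flip: zak_parseval add: zak_right_translation l2_inner_cfun_scale_right)
  \<comment> \<open>Squaring brings in \<open>card H\<close> twice and Plancherel returns it once,
    so one positive factor cancels.\<close>
  have "?N\<^sup>2 * ?S = (\<Sum>h\<in>H. (cmod (of_nat (card H) * l2_inner (carrier G) g (R h f)))\<^sup>2)"
    by (simp add: norm_mult power_mult_distrib sum_distrib_left)
  also have "\<dots> = ?N * ?T"
    by (simp add: * plancherel)
  finally show ?thesis
    using card_H_pos by (simp add: power2_eq_square)
qed

lemma frame_sum_all_translates:
  "real (card H) * (\<Sum>i\<in>H \<times> J. (cmod (l2_inner (carrier G) g ((\<lambda>(h, j). R h (f j)) i)))\<^sup>2)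
     = (\<Sum>\<alpha>\<in>chars. \<Sum>j\<in>J. (cmod (l2_inner \<Omega> (Z g \<alpha>) (Z (f j) \<alpha>)))\<^sup>2)"
proof -
  have "(\<Sum>i\<in>H \<times> J. (cmod (l2_inner (carrier G) g ((\<lambda>(h, j). R h (f j)) i)))\<^sup>2)
      = (\<Sum>j\<in>J. \<Sum>h\<in>H. (cmod (l2_inner (carrier G) g (R h (f j))))\<^sup>2)"
    by (subst sum.swap) (simp add: sum.cartesian_product case_prod_unfold)
  then show ?thesis
    by (simp add: sum_distrib_left[of _ _ J] frame_sum_translates) (rule sum.swap)
qed

section \<open>Spans of the translates and of their fibres\<close>

abbreviation "S f J \<equiv> cfun.span ((\<lambda>(h, j). R h (f j)) ` (H \<times> J))"
abbreviation "JA f J \<alpha> \<equiv> cfun.span ((\<lambda>j. Z (f j) \<alpha>) ` J)"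

text \<open>At a fixed character the transform is linear and sends the generator
  \<open>R h (f j)\<close> to a multiple of \<open>Z (f j) \<alpha>\<close>.\<close>

lemma zak_span:
  assumes "g \<in> S f J" and \<alpha>: "\<alpha> \<in> chars"
  shows "Z g \<alpha> \<in> JA f J \<alpha>"
  using assms(1)
proof (induction rule: cfun.span_induct)
  \<comment> \<open>In this induction \<open>base\<close> asks that the property define a subspace,
    and \<open>step\<close> treats the generators.\<close>
  case base
  show ?case
    by (auto simp: cfun.subspace_def zak_zero zak_add zak_cfun_scale
        intro: cfun.span_zero cfun.span_add cfun.span_scale)
next
  case (step x)
  then show ?case
    by (clarsimp simp: zak_right_translation[OF _ \<alpha>]) (intro cfun.span_scale cfun.span_base imageI)
qed

text \<open>The property is linear in \<open>u\<close>, so it is enough to isolate one fibre of a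
  single \<open>f j\<close>. The resulting \<open>g\<close> is the test vector that carries bounds
  on \<open>S f J\<close> over to one fibre.\<close>

lemma zak_isolate_fibre:
  assumes "u \<in> JA f J \<alpha>" and \<alpha>: "\<alpha> \<in> chars"
  shows "\<exists>g\<in>S f J. \<forall>\<beta>\<in>chars. Z g \<beta> = (if \<beta> = \<alpha> then u else 0)"
  using assms(1)
proof (induction rule: cfun.span_induct)
  case base
  show ?case
    unfolding cfun.subspace_def mem_Collect_eq
  proof (intro conjI allI impI ballI)
    show "\<exists>g\<in>S f J. \<forall>\<beta>\<in>chars. Z g \<beta> = (if \<beta> = \<alpha> then 0 else 0)"
      by (rule bexI[of _ 0]) (auto simp: zak_zero cfun.span_zero)
  next
    fix u v
    assume "u \<in> {u. \<exists>g\<in>S f J. \<forall>\<beta>\<in>chars. Z g \<beta> = (if \<beta> = \<alpha> then u else 0)}"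
      and "v \<in> {u. \<exists>g\<in>S f J. \<forall>\<beta>\<in>chars. Z g \<beta> = (if \<beta> = \<alpha> then u else 0)}"
    then obtain g g' where "g \<in> S f J" "\<forall>\<beta>\<in>chars. Z g \<beta> = (if \<beta> = \<alpha> then u else 0)"
      "g' \<in> S f J" "\<forall>\<beta>\<in>chars. Z g' \<beta> = (if \<beta> = \<alpha> then v else 0)" by auto
    then show "\<exists>g\<in>S f J. \<forall>\<beta>\<in>chars. Z g \<beta> = (if \<beta> = \<alpha> then u + v else 0)"
      by (intro bexI[of _ "g + g'"]) (auto simp: zak_add intro: cfun.span_add)
  next
    fix c u
    assume "u \<in> {u. \<exists>g\<in>S f J. \<forall>\<beta>\<in>chars. Z g \<beta> = (if \<beta> = \<alpha> then u else 0)}"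
    then obtain g where "g \<in> S f J" "\<forall>\<beta>\<in>chars. Z g \<beta> = (if \<beta> = \<alpha> then u else 0)" by auto
    then show "\<exists>g\<in>S f J. \<forall>\<beta>\<in>chars. Z g \<beta> = (if \<beta> = \<alpha> then cfun_scale c u else 0)"
      by (intro bexI[of _ "cfun_scale c g"]) (auto simp: zak_cfun_scale intro: cfun.span_scale)
  qed
next
  case (step u)
  then obtain j where j: "j \<in> J" "u = Z (f j) \<alpha>" by auto
  \<comment> \<open>Fourier inversion on \<open>H\<close>: on the fibre at \<open>\<beta>\<close>
    the translate by \<open>h\<close> contributes \<open>cnj (\<beta> h)\<close>, so these weights
    add up to 1 if \<open>\<beta> = \<alpha>\<close> and to 0 otherwise.\<close>
  define g where "g = (\<Sum>h\<in>H. cfun_scale (\<alpha> h / of_nat (card H)) (R h (f j)))"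
  have "g \<in> S f J"
    unfolding g_def using j(1) by (intro cfun.span_sum cfun.span_scale cfun.span_base) auto
  moreover have "Z g \<beta> = (if \<beta> = \<alpha> then u else 0)" if \<beta>: "\<beta> \<in> chars" for \<beta>
  proof -
    have "Z g \<beta> = (\<Sum>h\<in>H. cfun_scale (\<alpha> h / of_nat (card H) * cnj (\<beta> h)) (Z (f j) \<beta>))"
      by (simp add: g_def zak_sum zak_cfun_scale zak_right_translation \<beta> cfun.scale_scale)
    also have "\<dots> = cfun_scale ((\<Sum>h\<in>H. \<alpha> h * cnj (\<beta> h)) / of_nat (card H)) (Z (f j) \<beta>)"
      by (simp add: cfun.scale_sum_left[symmetric] sum_divide_distrib)
    also have "\<dots> = (if \<beta> = \<alpha> then u else 0)"
      using card_H_pos by (simp add: characters_orthogonal[OF \<alpha> \<beta>] j(2))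
    finally show ?thesis .
  qed
  ultimately show ?case by blast
qed

section \<open>Transfer of the frame bounds\<close>

lemma is_frame_span_translates:
  assumes "finite J" "A > 0" "B > 0"
  shows "is_frame (carrier G) (S f J) (H \<times> J) (\<lambda>(h, j). R h (f j)) A B \<longleftrightarrow>
    (\<forall>g\<in>S f J.
      A * (l2_norm (carrier G) g)\<^sup>2
        \<le> (\<Sum>i\<in>H \<times> J. (cmod (l2_inner (carrier G) g ((\<lambda>(h, j). R h (f j)) i)))\<^sup>2) \<and>
      (\<Sum>i\<in>H \<times> J. (cmod (l2_inner (carrier G) g ((\<lambda>(h, j). R h (f j)) i)))\<^sup>2)
        \<le> B * (l2_norm (carrier G) g)\<^sup>2)"
proof -
  \<comment> \<open>The translates vanish off the carrier by definition; beyond this inclusion only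
    the two inequalities of \<open>is_frame\<close> carry content.\<close>
  have "S f J \<subseteq> L2 (carrier G)"
    by (rule cfun.span_minimal[OF _ subspace_L2]) (auto simp: L2_def right_translation_def)
  then show ?thesis
    using assms finite_G finite_H
    by (simp add: is_frame_def cfun.span_superset)
qed

lemma is_frame_span_zak:
  assumes "finite J" "A > 0" "B > 0"
  shows "is_frame \<Omega> (JA f J \<alpha>) J (\<lambda>j. Z (f j) \<alpha>) A B \<longleftrightarrow>
    (\<forall>u\<in>JA f J \<alpha>.
      A * (l2_norm \<Omega> u)\<^sup>2 \<le> (\<Sum>j\<in>J. (cmod (l2_inner \<Omega> u (Z (f j) \<alpha>)))\<^sup>2) \<and>
      (\<Sum>j\<in>J. (cmod (l2_inner \<Omega> u (Z (f j) \<alpha>)))\<^sup>2) \<le> B * (l2_norm \<Omega> u)\<^sup>2)"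
proof -
  have "JA f J \<alpha> \<subseteq> L2 \<Omega>"
    by (rule cfun.span_minimal[OF _ subspace_L2]) (auto simp: zak_in_L2)
  then show ?thesis
    using assms finite_subset[OF transversal_subset finite_G]
    by (simp add: is_frame_def cfun.span_superset)
qed

text \<open>The squared norm and the frame sum of \<open>g\<close> become sums over fibres after
  multiplication by the same factor \<open>card H\<close>, so \<open>A\<close> and \<open>B\<close>
  pass unchanged.\<close>

lemma frame_translates_iff_frame_fibres:
  assumes J: "finite J" "A > 0" "B > 0"
  shows "is_frame (carrier G) (S f J) (H \<times> J) (\<lambda>(h, j). R h (f j)) A B \<longleftrightarrow>
    (\<forall>\<alpha>\<in>chars. is_frame \<Omega> (JA f J \<alpha>) J (\<lambda>j. Z (f j) \<alpha>) A B)"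
proof -
  define q where "q u \<alpha> = (\<Sum>j\<in>J. (cmod (l2_inner \<Omega> u (Z (f j) \<alpha>)))\<^sup>2)" for u \<alpha>
  define p where "p g = (\<Sum>i\<in>H \<times> J. (cmod (l2_inner (carrier G) g ((\<lambda>(h, j). R h (f j)) i)))\<^sup>2)" for g
  have p: "real (card H) * p g = (\<Sum>\<alpha>\<in>chars. q (Z g \<alpha>) \<alpha>)" for g
    unfolding p_def q_def by (rule frame_sum_all_translates)
  have scale: "c * (\<Sum>\<alpha>\<in>chars. (l2_norm \<Omega> (Z g \<alpha>))\<^sup>2)
      = real (card H) * (c * (l2_norm (carrier G) g)\<^sup>2)" for c g
    by (simp add: zak_norm)
  show ?thesis
    unfolding is_frame_span_translates[OF J] is_frame_span_zak[OF J]
      q_def[symmetric] p_def[symmetric]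
  proof (intro iffI ballI)
    fix \<alpha> u
    assume i: "\<forall>g\<in>S f J. A * (l2_norm (carrier G) g)\<^sup>2 \<le> p g \<and> p g \<le> B * (l2_norm (carrier G) g)\<^sup>2"
      and \<alpha>: "\<alpha> \<in> chars" and u: "u \<in> JA f J \<alpha>"
    \<comment> \<open>The fibres of \<open>g\<close> vanish except for \<open>u\<close> at
      \<open>\<alpha>\<close>. Each sum over characters thus reduces to one term, and the bounds for
      \<open>g\<close> become those for \<open>u\<close>.\<close>
    obtain g where g: "g \<in> S f J" "\<And>\<beta>. \<beta> \<in> chars \<Longrightarrow> Z g \<beta> = (if \<beta> = \<alpha> then u else 0)"
      using zak_isolate_fibre[OF u \<alpha>] by blast
    have "(\<Sum>\<beta>\<in>chars. q (Z g \<beta>) \<beta>) = (\<Sum>\<beta>\<in>chars. if \<beta> = \<alpha> then q u \<alpha> else 0)"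
      by (intro sum.cong refl) (simp add: g(2), simp add: q_def l2_zero)
    then have pg: "real (card H) * p g = q u \<alpha>"
      using \<alpha> finite_characters by (simp add: p)
    have "(\<Sum>\<beta>\<in>chars. (l2_norm \<Omega> (Z g \<beta>))\<^sup>2) = (\<Sum>\<beta>\<in>chars. if \<beta> = \<alpha> then (l2_norm \<Omega> u)\<^sup>2 else 0)"
      by (intro sum.cong refl) (simp add: g(2) l2_zero)
    then have ng: "(\<Sum>\<beta>\<in>chars. (l2_norm \<Omega> (Z g \<beta>))\<^sup>2) = (l2_norm \<Omega> u)\<^sup>2"
      using \<alpha> finite_characters by simp
    have "real (card H) * (A * (l2_norm (carrier G) g)\<^sup>2) \<le> real (card H) * p g"
      "real (card H) * p g \<le> real (card H) * (B * (l2_norm (carrier G) g)\<^sup>2)"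
      using i g(1) by (auto intro!: mult_left_mono)
    then show "A * (l2_norm \<Omega> u)\<^sup>2 \<le> q u \<alpha> \<and> q u \<alpha> \<le> B * (l2_norm \<Omega> u)\<^sup>2"
      unfolding pg scale[symmetric] ng by simp
  next
    fix g
    assume ii: "\<forall>\<alpha>\<in>chars. \<forall>u\<in>JA f J \<alpha>.
        A * (l2_norm \<Omega> u)\<^sup>2 \<le> q u \<alpha> \<and> q u \<alpha> \<le> B * (l2_norm \<Omega> u)\<^sup>2"
      and g: "g \<in> S f J"
    \<comment> \<open>Every fibre of \<open>g\<close> lies in the corresponding
      \<open>JA f J \<alpha>\<close>, so the fibre bounds can be added over all characters.\<close>
    have "A * (\<Sum>\<alpha>\<in>chars. (l2_norm \<Omega> (Z g \<alpha>))\<^sup>2) \<le> (\<Sum>\<alpha>\<in>chars. q (Z g \<alpha>) \<alpha>)"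
      "(\<Sum>\<alpha>\<in>chars. q (Z g \<alpha>) \<alpha>) \<le> B * (\<Sum>\<alpha>\<in>chars. (l2_norm \<Omega> (Z g \<alpha>))\<^sup>2)"
      unfolding sum_distrib_left using ii zak_span[OF g] by (auto intro!: sum_mono)
    then show "A * (l2_norm (carrier G) g)\<^sup>2 \<le> p g \<and> p g \<le> B * (l2_norm (carrier G) g)\<^sup>2"
      unfolding scale p[symmetric] using card_H_pos by simp
  qed
qed

end

theorem corollary2:
  fixes G :: "('a, 'b) monoid_scheme"
    and H \<Omega> :: "'a set"
    and n :: nat
    and f :: "nat \<Rightarrow> 'a \<Rightarrow> complex"
    and A B :: real
  assumes "group G"
    and "finite (carrier G)"
    and "subgroup H G"
    and "comm_group (G\<lparr>carrier := H\<rparr>)"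
    and "is_transversal G H \<Omega>"
    and "\<And>j. j \<in> {1..n} \<Longrightarrow> f j \<in> L2 (carrier G)"
    and "A > 0"
    and "B > 0"
  shows "is_frame (carrier G)
           (cfun.span ((\<lambda>(h, j). right_translation G h (f j)) ` (H \<times> {1..n})))
           (H \<times> {1..n}) (\<lambda>(h, j). right_translation G h (f j)) A B
     \<longleftrightarrow> (\<forall>\<alpha>\<in>characters G H.
           is_frame \<Omega>
             (cfun.span ((\<lambda>j. zak G H \<Omega> (f j) \<alpha>) ` {1..n}))
             {1..n} (\<lambda>j. zak G H \<Omega> (f j) \<alpha>) A B)"
proof -
  interpret group G by fact
  have "finite H"
    using assms(2) subgroup.subset[OF assms(3)] by (rule finite_subset[rotated])
  then interpret zak_transform G H \<Omega>
    by (intro zak_transform.intro finite_abelian_subgroup.intro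
        finite_abelian_subgroup_axioms.intro zak_transform_axioms.intro assms)
  show ?thesis
    using frame_translates_iff_frame_fibres[OF finite_atLeastAtMost assms(7,8)] .
qed

end
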